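(* Let $r\ge 4$ and let $\lambda=\alpha_1+\alpha_2+\cdots+\alpha_r$ be the weight of $\mathfrak{so}_{2r}(\mathbb C)$ given by the sum of the simple roots. Then $|\mathcal A(\lambda,0)|=2L_{r-3}$, where $L_k$ denotes the $k$-th Lucas number.
   Context: Let $\varepsilon_1,\ldots,\varepsilon_r$ be the standard basis of $\mathbb R^r$. The simple roots of $\mathfrak{so}_{2r}(\mathbb C)$ are $\alpha_i=\varepsilon_i-\varepsilon_{i+1}$ for $1\le i\le r-1$ and $\alpha_r=\varepsilon_{r-1}+\varepsilon_r$; the positive roots are $\Phi^+=\{\varepsilon_i\pm\varepsilon_j:1\le i<j\le r\}$. Set $\rho=\frac12\sum_{\alpha\in\Phi^+}\alpha$. The Weyl group $W$ is generated by the simple reflections $s_i$ in the hyperplanes orthogonal to $\alpha_i$, $1\le i\le r$. Kostant's partition function $\wp(\xi)$ is the number of ways to write $\xi$ as a nonnegative integral linear combination of positive roots (so $\wp(0)=1$). For integral weights $\lambda,\mu$ (not necessarily dominant), the Weyl alternation set is $\mathcal A(\lambda,\mu)=\{\sigma\in W:\wp(\sigma(\lambda+\rho)-(\mu+\rho))>0\}$. Lucas numbers: $L_1=1$, $L_2=3$, $L_n=L_{n-1}+L_{n-2}$. *)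

theory Defs
  imports Complex_Main "HOL-Library.FuncSet" "HOL-Library.Function_Algebras"
    "HOL-Algebra.Bij" "HOL-Algebra.Generated_Groups"
begin

text \<open>
  Vectors of \<open>\<real>\<^sup>r\<close> are functions \<open>nat \<Rightarrow> real\<close> whose coordinates of
  interest are those with index in \<open>{1..r}\<close>; all roots and weights below vanish at the
  other indices. Addition and subtraction are pointwise.
\<close>

type_synonym vec = "nat \<Rightarrow> real"

definition eps :: "nat \<Rightarrow> vec" where
  "eps i = (\<lambda>k. if k = i then 1 else 0)"

definition scale :: "real \<Rightarrow> vec \<Rightarrow> vec" where
  "scale a v = (\<lambda>k. a * v k)"

definition ip :: "nat \<Rightarrow> vec \<Rightarrow> vec \<Rightarrow> real" where
  "ip r u v = (\<Sum>k\<in>{1..r}. u k * v k)"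

definition simple_root :: "nat \<Rightarrow> nat \<Rightarrow> vec" where
  "simple_root r i = (if i < r then eps i - eps (i + 1) else eps (r - 1) + eps r)"

definition pos_roots :: "nat \<Rightarrow> vec set" where
  "pos_roots r = {eps i - eps j | i j. 1 \<le> i \<and> i < j \<and> j \<le> r}
               \<union> {eps i + eps j | i j. 1 \<le> i \<and> i < j \<and> j \<le> r}"

definition rho :: "nat \<Rightarrow> vec" where
  "rho r = scale (1/2) (\<Sum>\<alpha>\<in>pos_roots r. \<alpha>)"

definition reflection :: "nat \<Rightarrow> vec \<Rightarrow> vec \<Rightarrow> vec" where
  "reflection r \<alpha> v = v - scale (2 * ip r v \<alpha> / ip r \<alpha> \<alpha>) \<alpha>"

text \<open>
  The simple reflections fix all coordinates outside \<open>{1..r}\<close>, so the group they generate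
  inside the bijections of \<open>nat \<Rightarrow> real\<close> restricts faithfully to \<open>\<real>\<^sup>r\<close>, and its
  elements correspond one-to-one to those of the Weyl group acting on \<open>\<real>\<^sup>r\<close>.
\<close>

definition weyl_group :: "nat \<Rightarrow> (vec \<Rightarrow> vec) set" where
  "weyl_group r =
     generate (BijGroup UNIV) ((\<lambda>i. reflection r (simple_root r i)) ` {1..r})"

text \<open>
  A decomposition of \<open>\<xi>\<close> is a family of multiplicities \<open>c\<close> on the positive roots;
  extensionality of \<open>c\<close> makes distinct functions distinct decompositions. The set of
  decompositions is finite, since the positive roots lie in an open half-space of
  \<open>\<real>\<^sup>r\<close>, so \<open>card\<close> is the true count.
\<close>

definition partition_fun :: "nat \<Rightarrow> vec \<Rightarrow> nat" where
  "partition_fun r \<xi> =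
     card {c \<in> pos_roots r \<rightarrow>\<^sub>E (UNIV :: nat set).
             (\<Sum>\<alpha>\<in>pos_roots r. scale (real (c \<alpha>)) \<alpha>) = \<xi>}"

definition alternation_set :: "nat \<Rightarrow> vec \<Rightarrow> vec \<Rightarrow> (vec \<Rightarrow> vec) set" where
  "alternation_set r lam mu =
     {\<sigma> \<in> weyl_group r. partition_fun r (\<sigma> (lam + rho r) - (mu + rho r)) > 0}"

text \<open>\<open>L\<^sub>0 = 2\<close> is the value forced by the recurrence from \<open>L\<^sub>1 = 1\<close>, \<open>L\<^sub>2 = 3\<close>.\<close>

fun lucas :: "nat \<Rightarrow> nat" where
  "lucas 0 = 2"
| "lucas (Suc 0) = 1"
| "lucas (Suc (Suc n)) = lucas (Suc n) + lucas n"

end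

theory Submission
  imports Defs "HOL-Combinatorics.Permutations"
begin

text \<open>
  Since \<open>\<lambda> = \<epsilon>\<^sub>1 + \<epsilon>\<^bsub>r-1\<^esub>\<close> and \<open>\<rho> = (r - 1, r - 2, \<dots>, 1, 0)\<close>, the shifted weight is
  \<open>\<lambda> + \<rho> = (r, r - 2, r - 3, \<dots>, 3, 2, 2, 0)\<close>. An element of the Weyl group acts on it by a
  permutation of the entries together with an even number of sign changes
  (\<open>weyl_group_even_signed_perm\<close>), and it belongs to the alternation set exactly if the
  resulting vector \<open>v\<close> has \<open>\<xi> = v - \<rho>\<close> in the cone of nonnegative integral combinations of the
  simple roots: every positive root lies in that cone, and the simple roots are positive roots.

  Apart from integrality, the cone is cut out by few inequalities: the partial sums of \<open>\<xi>\<close>, and the total sum of \<open>\<xi>\<close>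
  with the sign of the last entry reversed, are nonnegative (\<open>partition_fun_pos_imp\<close>, and
  \<open>partition_fun_pos_partial_sums\<close> for the converse). The entries of \<open>\<lambda> + \<rho>\<close> add up to only \<open>2\<close>
  more than those of \<open>\<rho>\<close>. Negating an entry, which is \<open>0\<close> or at least \<open>2\<close>, costs twice
  its value, so no nonzero entry is negated; by parity \<open>0\<close> is not negated
  either. The reversed sum forces the last entry of \<open>v\<close> to be \<open>0\<close>, and the
  first partial sum forces the first entry to be \<open>r\<close>. This leaves the permutations of the
  positions \<open>2, \<dots>, r - 1\<close> whose partial sums never fall more than \<open>1\<close> short of those of \<open>\<rho>\<close>; the
  slack \<open>1\<close> is what the first entry contributes (\<open>alternation_set_subset\<close>,
  \<open>alternation_set_supset\<close>).

  Such permutations are counted by the Lucas recurrence (\<open>card_near_dominating\<close>). If the first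
  of the remaining positions receives its own entry, nothing has changed and one position is
  settled. Otherwise it must receive the next smaller entry, the slack is then used up, and
  the following position has no choice but to receive the entry passed over, which restores
  the slack with two positions settled. As permutations of positions are counted, the two equal
  entries \<open>2\<close> are told apart, which accounts for the factor \<open>2\<close>: with two or three positions left
  all \<open>2 = 2L\<^sub>1\<close> or \<open>6 = 2L\<^sub>2\<close> permutations qualify.
\<close>

section \<open>Permutations whose partial sums nearly dominate\<close>

text \<open>
  Here \<open>r - k\<close> is the entry of \<open>\<rho>\<close> at position \<open>k\<close>, and \<open>max 2 (r - k)\<close> the entry of \<open>\<lambda> + \<rho>\<close> at
  position \<open>k\<close> if \<open>2 \<le> k < r\<close>. The start \<open>a\<close> varies so that the set can be described recursively;
  the alternation set corresponds to \<open>a = 2\<close>.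
\<close>

definition near_dominating :: "nat \<Rightarrow> nat \<Rightarrow> (nat \<Rightarrow> nat) set" where
  "near_dominating r a = {\<pi>. \<pi> permutes {a..<r} \<and>
     (\<forall>t\<in>{a..r}. (\<Sum>k=a..<t. r - k) \<le> 1 + (\<Sum>k=a..<t. max 2 (r - \<pi> k)))}"

lemma finite_near_dominating: "finite (near_dominating r a)"
  by (rule finite_subset[OF _ finite_permutations[of "{a..<r}"]])
     (auto simp: near_dominating_def)

text \<open>
  With at most three positions left the entries of \<open>\<rho>\<close> are final segments of \<open>3, 2, 1\<close>, and any
  \<open>d\<close> entries that are at least \<open>2\<close> come within \<open>1\<close> of the first \<open>d\<close> of them.
\<close>

lemma near_dominating_small:
  assumes "m \<le> 3"
  shows "near_dominating (a + m) a = {\<pi>. \<pi> permutes {a..<a + m}}"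
proof -
  have "(\<Sum>k=a..<t. a + m - k) \<le> 1 + (\<Sum>k=a..<t. max 2 (a + m - \<pi> k))"
    if "t \<in> {a..a + m}" for t and \<pi> :: "nat \<Rightarrow> nat"
  proof -
    define d where "d = t - a"
    have d: "t = a + d" "d \<le> m" using that by (auto simp: d_def)
    have "(\<Sum>k=a..<t. a + m - k) = (\<Sum>k=0..<d. m - k)"
      using sum.shift_bounds_nat_ivl[of "\<lambda>k. a + m - k" 0 a d] d by (simp add: add.commute)
    also have "\<dots> \<le> 1 + 2 * d"
    proof -
      have "d \<in> {0, 1, 2, 3}" "m \<in> {0, 1, 2, 3}" using d assms by auto
      then show ?thesis by (auto simp: numeral_eq_Suc)
    qed
    also have "2 * d = (\<Sum>k=a..<t. 2)" using d by simp
    also have "\<dots> \<le> (\<Sum>k=a..<t. max 2 (a + m - \<pi> k))" by (intro sum_mono) simp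
    finally show ?thesis by simp
  qed
  then show ?thesis by (auto simp: near_dominating_def)
qed

text \<open>
  If position \<open>a\<close> keeps its own entry \<open>r - a\<close>, which is at least \<open>2\<close>, that entry cancels from
  both sides of every inequality.
\<close>

lemma near_dominating_fix:
  assumes "a + 2 \<le> r"
  shows "{\<pi> \<in> near_dominating r a. \<pi> a = a} = near_dominating r (Suc a)"
proof
  have split: "(\<Sum>k=a..<t. f k) = f a + (\<Sum>k=Suc a..<t. f k)" if "a < t" for t and f :: "nat \<Rightarrow> nat"
    using that by (simp add: sum.atLeast_Suc_lessThan)
  show "near_dominating r (Suc a) \<subseteq> {\<pi> \<in> near_dominating r a. \<pi> a = a}"
  proof
    fix \<pi> assume \<pi>: "\<pi> \<in> near_dominating r (Suc a)"
    then have p: "\<pi> permutes {Suc a..<r}" by (simp add: near_dominating_def)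
    then have fix_a: "\<pi> a = a" by (rule permutes_not_in) simp
    have "(\<Sum>k=a..<t. r - k) \<le> 1 + (\<Sum>k=a..<t. max 2 (r - \<pi> k))" if "t \<in> {a..r}" for t
    proof (cases "t = a")
      case False
      then have "t \<in> {Suc a..r}" "a < t" using that by auto
      moreover have "(\<Sum>k=Suc a..<t. r - k) \<le> 1 + (\<Sum>k=Suc a..<t. max 2 (r - \<pi> k))"
        using \<pi> \<open>t \<in> {Suc a..r}\<close> by (auto simp: near_dominating_def)
      ultimately show ?thesis using fix_a by (simp add: split)
    qed simp
    moreover have "\<pi> permutes {a..<r}" by (rule permutes_subset[OF p]) auto
    ultimately show "\<pi> \<in> {\<pi> \<in> near_dominating r a. \<pi> a = a}"
      using fix_a by (simp add: near_dominating_def)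
  qed
  show "{\<pi> \<in> near_dominating r a. \<pi> a = a} \<subseteq> near_dominating r (Suc a)"
  proof
    fix \<pi> assume \<pi>: "\<pi> \<in> {\<pi> \<in> near_dominating r a. \<pi> a = a}"
    then have p: "\<pi> permutes {a..<r}" and fix_a: "\<pi> a = a" by (auto simp: near_dominating_def)
    have "(\<Sum>k=Suc a..<t. r - k) \<le> 1 + (\<Sum>k=Suc a..<t. max 2 (r - \<pi> k))"
      if t: "t \<in> {Suc a..r}" for t
    proof -
      have "t \<in> {a..r}" using t by simp
      then have "(\<Sum>k=a..<t. r - k) \<le> 1 + (\<Sum>k=a..<t. max 2 (r - \<pi> k))"
        using \<pi> by (auto simp: near_dominating_def)
      then show ?thesis using t fix_a assms by (simp add: split)
    qed
    moreover have "\<pi> permutes {Suc a..<r}"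
      by (rule permutes_superset[OF p]) (use fix_a in \<open>auto simp: not_less_eq_eq le_antisym\<close>)
    ultimately show "\<pi> \<in> near_dominating r (Suc a)" by (simp add: near_dominating_def)
  qed
qed

text \<open>
  If position \<open>a\<close> receives another entry, the slack of \<open>1\<close> only allows the entry \<open>r - a - 1\<close>. Then
  position \<open>a + 1\<close> needs an entry of at least \<open>r - a - 1\<close>, and the only one left is \<open>r - a\<close>.
  Both steps use that the entries from position \<open>a + 2\<close> on are smaller than
  \<open>r - a - 1\<close>, which holds for \<open>a + 4 \<le> r\<close> and fails at the repeated entry \<open>2\<close>.
\<close>

lemma near_dominating_move:
  assumes "a + 4 \<le> r"
  shows "{\<pi> \<in> near_dominating r a. \<pi> a \<noteq> a} =
    (\<lambda>\<pi>. Transposition.transpose a (Suc a) \<circ> \<pi>) ` near_dominating r (a + 2)"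
    (is "?L = ?\<tau> ` ?R")
proof -
  have split: "(\<Sum>k=a..<t. f k) = f a + f (Suc a) + (\<Sum>k=a + 2..<t. f k)"
    if "a + 2 \<le> t" for t and f :: "nat \<Rightarrow> nat"
    using that by (simp add: sum.atLeast_Suc_lessThan)
  have swap_val: "max 2 (r - \<pi> a) + max 2 (r - \<pi> (Suc a)) = (r - a) + (r - Suc a)"
    if "\<pi> a = Suc a" "\<pi> (Suc a) = a" for \<pi> :: "nat \<Rightarrow> nat"
    using that assms by simp
  have comp: "?\<tau> \<pi> \<in> ?L \<longleftrightarrow> \<pi> \<in> ?R" if p: "\<pi> permutes {a + 2..<r}" for \<pi>
  proof -
    have fixes_ab: "\<pi> a = a" "\<pi> (Suc a) = Suc a"
      using permutes_not_in[OF p] by simp_all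
    have rest: "?\<tau> \<pi> k = \<pi> k" if "k \<ge> a + 2" for k
    proof -
      have "\<pi> k \<noteq> a" "\<pi> k \<noteq> Suc a"
        using that fixes_ab permutes_inj[OF p]
        by (metis Suc_n_not_le_n add_2_eq_Suc' injD le_SucI not_less_eq_eq)+
      then show ?thesis by simp
    qed
    have perm: "?\<tau> \<pi> permutes {a..<r}"
    proof (rule permutes_compose)
      show "\<pi> permutes {a..<r}" by (rule permutes_subset[OF p]) auto
      show "Transposition.transpose a (Suc a) permutes {a..<r}"
        using assms by (intro permutes_swap_id) auto
    qed
    have iff: "(\<Sum>k=a..<t. r - k) \<le> 1 + (\<Sum>k=a..<t. max 2 (r - ?\<tau> \<pi> k)) \<longleftrightarrow>
        (\<Sum>k=a + 2..<t. r - k) \<le> 1 + (\<Sum>k=a + 2..<t. max 2 (r - \<pi> k))"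
      if "a + 2 \<le> t" for t
    proof -
      have "(\<Sum>k=a + 2..<t. max 2 (r - ?\<tau> \<pi> k)) = (\<Sum>k=a + 2..<t. max 2 (r - \<pi> k))"
        by (intro sum.cong refl arg_cong2[where f = max] arg_cong2[where f = minus] rest) simp
      moreover have "max 2 (r - ?\<tau> \<pi> a) + max 2 (r - ?\<tau> \<pi> (Suc a)) = (r - a) + (r - Suc a)"
        using fixes_ab by (intro swap_val) simp_all
      ultimately show ?thesis unfolding split[OF that] by linarith
    qed
    have early: "(\<Sum>k=a..<t. r - k) \<le> 1 + (\<Sum>k=a..<t. max 2 (r - ?\<tau> \<pi> k))"
      if "t \<in> {a..r}" "\<not> a + 2 \<le> t" for t
    proof -
      have "t = a \<or> t = Suc a" using that by auto
      then show ?thesis using assms fixes_ab by auto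
    qed
    have moved: "?\<tau> \<pi> a \<noteq> a" using fixes_ab by simp
    show ?thesis
    proof
      assume L: "?\<tau> \<pi> \<in> ?L"
      have "(\<Sum>k=a + 2..<t. r - k) \<le> 1 + (\<Sum>k=a + 2..<t. max 2 (r - \<pi> k))"
        if t: "t \<in> {a + 2..r}" for t
      proof -
        have "t \<in> {a..r}" using t by simp
        then have "(\<Sum>k=a..<t. r - k) \<le> 1 + (\<Sum>k=a..<t. max 2 (r - ?\<tau> \<pi> k))"
          using L unfolding near_dominating_def by blast
        then show ?thesis using iff t by simp
      qed
      then show "\<pi> \<in> ?R" using p by (simp add: near_dominating_def)
    next
      assume R: "\<pi> \<in> ?R"
      have "(\<Sum>k=a..<t. r - k) \<le> 1 + (\<Sum>k=a..<t. max 2 (r - ?\<tau> \<pi> k))"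
        if t: "t \<in> {a..r}" for t
      proof (cases "a + 2 \<le> t")
        case True
        then have "t \<in> {a + 2..r}" using t by simp
        then have "(\<Sum>k=a + 2..<t. r - k) \<le> 1 + (\<Sum>k=a + 2..<t. max 2 (r - \<pi> k))"
          using R unfolding near_dominating_def by blast
        then show ?thesis using iff True by blast
      next
        case False
        then show ?thesis using early t by blast
      qed
      then show "?\<tau> \<pi> \<in> ?L" using perm moved unfolding near_dominating_def by blast
    qed
  qed
  have "\<exists>\<pi>'. \<pi> = ?\<tau> \<pi>' \<and> \<pi>' permutes {a + 2..<r}" if L: "\<pi> \<in> ?L" for \<pi>
  proof -
    from L have p: "\<pi> permutes {a..<r}" and moved: "\<pi> a \<noteq> a"
      and bound: "\<And>t. t \<in> {a..r} \<Longrightarrow>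
        (\<Sum>k=a..<t. r - k) \<le> 1 + (\<Sum>k=a..<t. max 2 (r - \<pi> k))"
      unfolding near_dominating_def by blast+
    have range: "\<pi> k \<in> {a..<r}" if "k \<in> {a..<r}" for k
      using permutes_in_image[OF p] that by blast
    \<comment> \<open>The inequality at \<open>t = a + 1\<close> determines \<open>\<pi> a\<close>, the one at \<open>t = a + 2\<close> then \<open>\<pi> (a + 1)\<close>.\<close>
    have first: "\<pi> a = Suc a"
    proof -
      have "r - a \<le> 1 + max 2 (r - \<pi> a)" using bound[of "Suc a"] assms by simp
      then show ?thesis using range[of a] moved assms by (auto simp: max_def split: if_splits)
    qed
    have "\<pi> (Suc a) = a"
    proof -
      have "(r - a) + (r - Suc a) \<le> 1 + (max 2 (r - \<pi> a) + max 2 (r - \<pi> (Suc a)))"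
        using bound[of "a + 2"] assms by (simp add: split)
      then have "r - Suc a \<le> max 2 (r - \<pi> (Suc a))" using first assms by simp
      moreover have "\<pi> (Suc a) \<noteq> Suc a" using first permutes_inj[OF p] by (metis injD n_not_Suc_n)
      ultimately show ?thesis using range[of "Suc a"] assms
        by (auto simp: max_def split: if_splits)
    qed
    have "?\<tau> \<pi> permutes {a..<r}"
      by (rule permutes_compose[OF p]) (use assms in \<open>intro permutes_swap_id; simp\<close>)
    then have "?\<tau> \<pi> permutes {a + 2..<r}"
    proof (rule permutes_superset)
      fix x assume "x \<in> {a..<r} - {a + 2..<r}"
      then have "x = a \<or> x = Suc a" by auto
      then show "?\<tau> \<pi> x = x" using first \<open>\<pi> (Suc a) = a\<close> by auto
    qed
    moreover have "\<pi> = ?\<tau> (?\<tau> \<pi>)" by (simp add: fun_eq_iff)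
    ultimately show ?thesis by blast
  qed
  note shape = this
  show ?thesis
  proof (intro equalityI subsetI)
    fix \<pi> assume L: "\<pi> \<in> ?L"
    then obtain \<pi>' where \<pi>': "\<pi> = ?\<tau> \<pi>'" "\<pi>' permutes {a + 2..<r}" using shape by blast
    have "\<pi>' \<in> ?R" using comp[OF \<pi>'(2)] L unfolding \<pi>'(1) by (rule iffD1)
    then show "\<pi> \<in> ?\<tau> ` ?R" unfolding \<pi>'(1) by (rule imageI)
  next
    fix \<pi> assume "\<pi> \<in> ?\<tau> ` ?R"
    then obtain \<pi>' where \<pi>': "\<pi> = ?\<tau> \<pi>'" and R: "\<pi>' \<in> ?R" by (rule imageE)
    have "\<pi>' permutes {a + 2..<r}" using R by (simp add: near_dominating_def)
    from comp[OF this] R show "\<pi> \<in> ?L" unfolding \<pi>' by (rule iffD2)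
  qed
qed

lemma card_near_dominating_rec:
  assumes "a + 4 \<le> r"
  shows "card (near_dominating r a) =
    card (near_dominating r (Suc a)) + card (near_dominating r (a + 2))"
proof -
  have "near_dominating r a =
      {\<pi> \<in> near_dominating r a. \<pi> a = a} \<union> {\<pi> \<in> near_dominating r a. \<pi> a \<noteq> a}" by blast
  also have "card \<dots> = card {\<pi> \<in> near_dominating r a. \<pi> a = a}
      + card {\<pi> \<in> near_dominating r a. \<pi> a \<noteq> a}"
    by (rule card_Un_disjoint) (auto simp: finite_near_dominating)
  also have "{\<pi> \<in> near_dominating r a. \<pi> a = a} = near_dominating r (Suc a)"
    using assms by (intro near_dominating_fix) simp
  also have "card {\<pi> \<in> near_dominating r a. \<pi> a \<noteq> a} = card (near_dominating r (a + 2))"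
    unfolding near_dominating_move[OF assms]
  proof (rule card_image, rule inj_onI)
    fix \<pi> \<pi>' :: "nat \<Rightarrow> nat"
    assume "Transposition.transpose a (Suc a) \<circ> \<pi> = Transposition.transpose a (Suc a) \<circ> \<pi>'"
    then show "\<pi> = \<pi>'" by (metis comp_id fun.map_comp id_comp transpose_comp_involutory)
  qed
  finally show ?thesis .
qed

lemma card_near_dominating:
  "r = a + m + 2 \<Longrightarrow> card (near_dominating r a) = 2 * lucas (Suc m)"
proof (induction m arbitrary: a rule: induct_nat_012)
  case 0
  then show ?case using near_dominating_small[of 2 a] card_permutations[of "{a..<a + 2}" 2]
    by (simp add: fact_numeral)
next
  case 1
  then show ?case using near_dominating_small[of 3 a] card_permutations[of "{a..<a + 3}" 3]
    by (simp add: fact_numeral numeral_eq_Suc)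
next
  case (ge2 m)
  have "a + 4 \<le> r" using ge2.prems by simp
  note rec = card_near_dominating_rec[OF this]
  have "card (near_dominating r (Suc a)) = 2 * lucas (Suc (Suc m))"
    by (rule ge2.IH(2)) (use ge2.prems in simp)
  moreover have "card (near_dominating r (a + 2)) = 2 * lucas (Suc m)"
    by (rule ge2.IH(1)) (use ge2.prems in simp)
  ultimately show ?case unfolding rec by simp
qed

section \<open>Roots, inner products and reflections\<close>

lemma sum_fun_apply: "(\<Sum>i\<in>A. f i) k = (\<Sum>i\<in>A. f i k)"
  for f :: "'a \<Rightarrow> 'b \<Rightarrow> 'c::comm_monoid_add"
  by (induction A rule: infinite_finite_induct) auto

lemma scale_apply [simp]: "scale a v k = a * v k"
  by (simp add: scale_def)

lemma ip_add_right: "ip r u (v + w) = ip r u v + ip r u w"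
  by (simp add: ip_def algebra_simps sum.distrib)

lemma ip_diff_right: "ip r u (v - w) = ip r u v - ip r u w"
  by (simp add: ip_def algebra_simps sum_subtractf)

lemma ip_scale_right: "ip r u (scale a v) = a * ip r u v"
  by (simp add: ip_def sum_distrib_left algebra_simps)

lemma ip_sum_right: "ip r u (\<Sum>i\<in>A. f i) = (\<Sum>i\<in>A. ip r u (f i))"
  unfolding ip_def sum_fun_apply sum_distrib_left by (rule sum.swap)

lemma ip_eps: "i \<in> {1..r} \<Longrightarrow> ip r u (eps i) = u i"
  by (simp add: ip_def eps_def if_distrib[of "\<lambda>x. _ * x"] cong: if_cong)

lemma pos_roots_cases:
  assumes "\<alpha> \<in> pos_roots r"
  obtains i j where "1 \<le> i" "i < j" "j \<le> r" "\<alpha> = eps i - eps j \<or> \<alpha> = eps i + eps j"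
  using assms unfolding pos_roots_def by blast

lemma simple_root_in_pos_roots:
  assumes "2 \<le> r" "i \<in> {1..r}"
  shows "simple_root r i \<in> pos_roots r"
proof (cases "i < r")
  case True
  then have "simple_root r i = eps i - eps (i + 1)" "1 \<le> i" "i < i + 1" "i + 1 \<le> r"
    using assms by (simp_all add: simple_root_def)
  then show ?thesis unfolding pos_roots_def by blast
next
  case False
  then have "simple_root r i = eps (r - 1) + eps r" "1 \<le> r - 1" "r - 1 < r" "r \<le> r"
    using assms by (simp_all add: simple_root_def)
  then show ?thesis unfolding pos_roots_def by blast
qed

text \<open>
  Sums over the positive roots are taken over the index pairs \<open>i < j\<close>, each of which gives the two
  roots \<open>\<epsilon>\<^sub>i - \<epsilon>\<^sub>j\<close> and \<open>\<epsilon>\<^sub>i + \<epsilon>\<^sub>j\<close>.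
\<close>

definition root_pairs :: "nat \<Rightarrow> (nat \<times> nat) set" where
  "root_pairs r = (SIGMA i:{1..r}. {i<..r})"

lemma finite_root_pairs: "finite (root_pairs r)"
  by (simp add: root_pairs_def)

lemma pos_roots_eq:
  "pos_roots r = (\<lambda>(i, j). eps i - eps j) ` root_pairs r \<union> (\<lambda>(i, j). eps i + eps j) ` root_pairs r"
  by (force simp: pos_roots_def root_pairs_def image_iff)

lemma finite_pos_roots: "finite (pos_roots r)"
  by (simp add: pos_roots_eq finite_root_pairs)

lemma eps_diff_eq_iff:
  assumes "i < j" "i' < j'" "eps i - eps j = eps i' - eps j'"
  shows "i = i' \<and> j = j'"
  using fun_cong[OF assms(3), of i] fun_cong[OF assms(3), of j] assms(1,2)
  by (auto simp: eps_def split: if_splits)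

lemma eps_add_eq_iff:
  assumes "i < j" "i' < j'" "eps i + eps j = eps i' + eps j'"
  shows "i = i' \<and> j = j'"
  using fun_cong[OF assms(3), of i] fun_cong[OF assms(3), of j] assms(1,2)
  by (auto simp: eps_def split: if_splits)

lemma eps_diff_neq_add:
  assumes "i < j" "i' < j'"
  shows "eps i - eps j \<noteq> eps i' + eps j'"
proof
  assume "eps i - eps j = eps i' + eps j'"
  from fun_cong[OF this, of j] show False using assms by (auto simp: eps_def split: if_splits)
qed

lemma sum_pos_roots: "(\<Sum>\<alpha>\<in>pos_roots r. f \<alpha>) =
  (\<Sum>(i, j)\<in>root_pairs r. f (eps i - eps j) + f (eps i + eps j))"
  for f :: "vec \<Rightarrow> 'a::comm_monoid_add"
proof -
  have "(\<Sum>\<alpha>\<in>pos_roots r. f \<alpha>) =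
      sum f ((\<lambda>(i, j). eps i - eps j) ` root_pairs r) + sum f ((\<lambda>(i, j). eps i + eps j) ` root_pairs r)"
    unfolding pos_roots_eq
    by (rule sum.union_disjoint)
       (auto simp: finite_root_pairs root_pairs_def dest: eps_diff_neq_add)
  also have "sum f ((\<lambda>(i, j). eps i - eps j) ` root_pairs r) =
      (\<Sum>(i, j)\<in>root_pairs r. f (eps i - eps j))"
    by (subst sum.reindex)
       (auto simp: inj_on_def root_pairs_def case_prod_unfold dest: eps_diff_eq_iff)
  also have "sum f ((\<lambda>(i, j). eps i + eps j) ` root_pairs r) =
      (\<Sum>(i, j)\<in>root_pairs r. f (eps i + eps j))"
    by (subst sum.reindex)
       (auto simp: inj_on_def root_pairs_def case_prod_unfold dest: eps_add_eq_iff)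
  finally show ?thesis by (simp only: sum.distrib[symmetric] case_prod_unfold)
qed

text \<open>
  The two roots of a pair \<open>i < j\<close> add up to \<open>2\<epsilon>\<^sub>i\<close>, and \<open>i\<close> is the smaller index of \<open>r - i\<close> pairs.
\<close>

lemma rho_apply: "rho r k = (if k \<in> {1..r} then real (r - k) else 0)"
proof -
  have "rho r k = (1/2) * (\<Sum>(i, j)\<in>root_pairs r. 2 * eps i k)"
    unfolding rho_def scale_apply sum_fun_apply sum_pos_roots[of "\<lambda>\<alpha>. \<alpha> k"]
    by (simp add: algebra_simps)
  also have "\<dots> = (\<Sum>(i, j)\<in>root_pairs r. eps i k)"
    by (simp add: sum_distrib_left case_prod_unfold)
  also have "\<dots> = (\<Sum>i\<in>{1..r}. \<Sum>j\<in>{i<..r}. eps i k)"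
    unfolding root_pairs_def by (rule sum.Sigma[symmetric]) auto
  also have "\<dots> = (\<Sum>i\<in>{1..r}. if i = k then real (r - k) else 0)"
    by (rule sum.cong) (auto simp: eps_def)
  finally show ?thesis by simp
qed

lemma reflection_diff:
  assumes "1 \<le> i" "i < j" "j \<le> r"
  shows "reflection r (eps i - eps j) v = v \<circ> Transposition.transpose i j"
proof -
  have "ip r v (eps i - eps j) = v i - v j"
    and "ip r (eps i - eps j) (eps i - eps j) = 2"
    using assms by (simp_all add: ip_diff_right ip_eps) (simp add: eps_def)
  then show ?thesis using assms
    by (simp add: reflection_def)
       (auto simp: fun_eq_iff eps_def Transposition.transpose_def field_simps)
qed

lemma reflection_add:
  assumes "1 \<le> i" "i < j" "j \<le> r"
  shows "reflection r (eps i + eps j) v =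
    (\<lambda>k. (if k = i \<or> k = j then -1 else 1) * v (Transposition.transpose i j k))"
proof -
  have "ip r v (eps i + eps j) = v i + v j"
    and "ip r (eps i + eps j) (eps i + eps j) = 2"
    using assms by (simp_all add: ip_add_right ip_eps) (simp add: eps_def)
  then show ?thesis using assms
    by (simp add: reflection_def)
       (auto simp: fun_eq_iff eps_def Transposition.transpose_def field_simps)
qed

section \<open>The Weyl group and signed permutations\<close>

lemma reflection_simple_root_involutive:
  assumes "2 \<le> r" "i \<in> {1..r}"
  shows "reflection r (simple_root r i) (reflection r (simple_root r i) v) = v"
  using assms by (auto simp: simple_root_def reflection_diff reflection_add o_assoc fun_eq_iff
      Transposition.transpose_def)

lemma reflection_simple_root_Bij:
  assumes "2 \<le> r" "i \<in> {1..r}"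
  shows "reflection r (simple_root r i) \<in> Bij UNIV"
  unfolding Bij_def using reflection_simple_root_involutive[OF assms]
  by (auto intro: involuntory_imp_bij)

lemma BijGroup_UNIV_simps:
  "carrier (BijGroup UNIV) = Bij UNIV"
  "\<one>\<^bsub>BijGroup UNIV\<^esub> = id"
  "g \<in> Bij UNIV \<Longrightarrow> h \<in> Bij UNIV \<Longrightarrow> g \<otimes>\<^bsub>BijGroup UNIV\<^esub> h = g \<circ> h"
  by (simp_all add: BijGroup_def compose_def restrict_def fun_eq_iff)

lemma weyl_group_subset_Bij:
  assumes "2 \<le> r"
  shows "weyl_group r \<subseteq> Bij UNIV"
proof -
  interpret group "BijGroup (UNIV :: vec set)" by (rule group_BijGroup)
  have "(\<lambda>i. reflection r (simple_root r i)) ` {1..r} \<subseteq> carrier (BijGroup UNIV)"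
    using reflection_simple_root_Bij[OF assms] by (auto simp: BijGroup_UNIV_simps)
  from generate_incl[OF this] show ?thesis
    by (simp add: weyl_group_def BijGroup_UNIV_simps(1))
qed

lemma weyl_group_comp:
  assumes "2 \<le> r" "g \<in> weyl_group r" "h \<in> weyl_group r"
  shows "g \<circ> h \<in> weyl_group r"
proof -
  have "g \<otimes>\<^bsub>BijGroup UNIV\<^esub> h \<in> weyl_group r"
    using assms(2,3) unfolding weyl_group_def by (rule generate.eng)
  moreover have "g \<in> Bij UNIV" "h \<in> Bij UNIV"
    using weyl_group_subset_Bij[OF assms(1)] assms(2,3) by auto
  ultimately show ?thesis by (simp add: BijGroup_UNIV_simps)
qed

lemma weyl_group_id: "id \<in> weyl_group r"
  unfolding weyl_group_def BijGroup_UNIV_simps(2)[symmetric] by (rule generate.one)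

lemma weyl_group_reflection: "i \<in> {1..r} \<Longrightarrow> reflection r (simple_root r i) \<in> weyl_group r"
  unfolding weyl_group_def by (rule generate.incl) blast

text \<open>
  The simple reflections are involutions, so inverses of generators need no case of their own.
\<close>

lemma weyl_group_induct [consumes 2, case_names id reflection comp]:
  assumes "\<sigma> \<in> weyl_group r" "2 \<le> r"
    and id: "P id"
    and refl: "\<And>i. i \<in> {1..r} \<Longrightarrow> P (reflection r (simple_root r i))"
    and comp: "\<And>g h. P g \<Longrightarrow> P h \<Longrightarrow> P (g \<circ> h)"
  shows "P \<sigma>"
proof -
  interpret group "BijGroup (UNIV :: vec set)" by (rule group_BijGroup)
  show ?thesis using assms(1) unfolding weyl_group_def
  proof (induction rule: generate.induct)
    case one
    show ?case unfolding BijGroup_UNIV_simps by (rule id)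
  next
    case (incl h)
    then show ?case using refl by blast
  next
    case (inv h)
    then obtain i where i: "i \<in> {1..r}" and h: "h = reflection r (simple_root r i)" by blast
    have Bij: "h \<in> Bij UNIV" using reflection_simple_root_Bij[OF assms(2) i] h by simp
    then have "h \<otimes>\<^bsub>BijGroup UNIV\<^esub> h = h \<circ> h" by (simp only: BijGroup_UNIV_simps)
    also have "h \<circ> h = \<one>\<^bsub>BijGroup UNIV\<^esub>" unfolding BijGroup_UNIV_simps
      by (rule ext) (simp only: h o_apply id_apply reflection_simple_root_involutive[OF assms(2) i])
    finally have "h \<otimes>\<^bsub>BijGroup UNIV\<^esub> h = \<one>\<^bsub>BijGroup UNIV\<^esub>" .
    then have "inv\<^bsub>BijGroup UNIV\<^esub> h = h"
      using Bij by (intro inv_equality) (simp_all add: BijGroup_UNIV_simps)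
    then show ?case using refl[OF i] h by simp
  next
    case (eng g h)
    then have "g \<in> Bij UNIV" "h \<in> Bij UNIV"
      using weyl_group_subset_Bij[OF assms(2)] by (auto simp: weyl_group_def)
    then show ?case using comp[OF eng.IH] by (simp only: BijGroup_UNIV_simps)
  qed
qed

text \<open>
  The pair \<open>\<pi>\<close>, \<open>s\<close> stands for the map \<open>v \<mapsto> (\<lambda>k. s k * v (\<pi> k))\<close>; that the product of the signs is
  \<open>1\<close> says that their negative values are even in number.
\<close>

definition even_signed_perm :: "nat \<Rightarrow> (nat \<Rightarrow> nat) \<Rightarrow> (nat \<Rightarrow> real) \<Rightarrow> bool" where
  "even_signed_perm r \<pi> s \<longleftrightarrow> \<pi> permutes {1..r} \<and> (\<forall>k. s k = 1 \<or> s k = -1) \<and>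
     (\<forall>k. k \<notin> {1..r} \<longrightarrow> s k = 1) \<and> (\<Prod>k\<in>{1..r}. s k) = 1"

lemma even_signed_perm_comp:
  assumes "even_signed_perm r \<pi> s" "even_signed_perm r \<pi>' s'"
  shows "even_signed_perm r (\<pi>' \<circ> \<pi>) (\<lambda>k. s k * s' (\<pi> k))"
proof -
  have p: "\<pi> permutes {1..r}" using assms(1) by (simp add: even_signed_perm_def)
  have "(\<Prod>k\<in>{1..r}. s' (\<pi> k)) = (\<Prod>k\<in>{1..r}. s' k)"
    using prod.permute[OF p, of s'] by (simp add: o_def)
  then have "(\<Prod>k\<in>{1..r}. s k * s' (\<pi> k)) = 1"
    using assms by (simp add: prod.distrib even_signed_perm_def)
  moreover have "s k * s' (\<pi> k) = 1" if "k \<notin> {1..r}" for k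
    using assms that permutes_not_in[OF p that] by (simp add: even_signed_perm_def)
  moreover have "s k * s' (\<pi> k) = 1 \<or> s k * s' (\<pi> k) = -1" for k
  proof -
    have "s k = 1 \<or> s k = -1" "s' (\<pi> k) = 1 \<or> s' (\<pi> k) = -1"
      using assms unfolding even_signed_perm_def by blast+
    then show ?thesis by auto
  qed
  moreover have "\<pi>' \<circ> \<pi> permutes {1..r}"
    using assms(2) by (intro permutes_compose[OF p]) (simp add: even_signed_perm_def)
  ultimately show ?thesis unfolding even_signed_perm_def by blast
qed

text \<open>
  The reflections in \<open>\<alpha>\<^sub>1, \<dots>, \<alpha>\<^bsub>r-1\<^esub>\<close> are adjacent transpositions; the one in \<open>\<alpha>\<^sub>r\<close> exchanges the last
  two coordinates and negates both.
\<close>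

lemma weyl_group_even_signed_perm:
  assumes "\<sigma> \<in> weyl_group r" "2 \<le> r"
  shows "\<exists>\<pi> s. even_signed_perm r \<pi> s \<and> \<sigma> = (\<lambda>v k. s k * v (\<pi> k))"
  using assms
proof (induction rule: weyl_group_induct)
  case id
  have "even_signed_perm r id (\<lambda>_. 1)" using permutes_id by (simp add: even_signed_perm_def)
  moreover have "id = (\<lambda>(v :: vec) k. 1 * v (id k))" by (simp add: fun_eq_iff)
  ultimately show ?case by blast
next
  case (reflection i)
  show ?case
  proof (cases "i < r")
    case True
    then have "even_signed_perm r (Transposition.transpose i (i + 1)) (\<lambda>_. 1)"
      using reflection by (auto simp: even_signed_perm_def intro!: permutes_swap_id)
    moreover have "reflection r (simple_root r i) =
        (\<lambda>v k. 1 * v (Transposition.transpose i (i + 1) k))"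
      using True reflection by (simp add: simple_root_def reflection_diff fun_eq_iff)
    ultimately show ?thesis by blast
  next
    case False
    let ?s = "\<lambda>k. if k = r - 1 \<or> k = r then -1 else (1::real)"
    have "(\<Prod>k\<in>{1..r}. ?s k) = (\<Prod>k\<in>{r - 1, r}. ?s k)"
      using assms(2) by (intro prod.mono_neutral_right) auto
    also have "\<dots> = 1" using assms(2) by simp
    finally have "even_signed_perm r (Transposition.transpose (r - 1) r) ?s"
      using assms(2) by (auto simp: even_signed_perm_def intro!: permutes_swap_id)
    moreover have "reflection r (simple_root r i) =
        (\<lambda>v k. ?s k * v (Transposition.transpose (r - 1) r k))"
      using False reflection assms(2) by (simp add: simple_root_def reflection_add fun_eq_iff)
    ultimately show ?thesis by blast
  qed
next
  case (comp g h)
  then obtain \<pi> s \<pi>' s' where "even_signed_perm r \<pi> s" "g = (\<lambda>v k. s k * v (\<pi> k))"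
    and "even_signed_perm r \<pi>' s'" "h = (\<lambda>v k. s' k * v (\<pi>' k))" by blast
  then have "even_signed_perm r (\<pi>' \<circ> \<pi>) (\<lambda>k. s k * s' (\<pi> k))"
    and "g \<circ> h = (\<lambda>v k. (s k * s' (\<pi> k)) * v ((\<pi>' \<circ> \<pi>) k))"
    by (simp_all only: even_signed_perm_comp) (simp add: fun_eq_iff)
  then show ?case by blast
qed

text \<open>
  Every transposition is obtained from adjacent ones by conjugation, which moves its second
  index one step at a time.
\<close>

lemma transpose_in_weyl_group:
  assumes "2 \<le> r" "1 \<le> a" "a + d + 1 \<le> r"
  shows "(\<lambda>v. v \<circ> Transposition.transpose a (a + d + 1)) \<in> weyl_group r"
proof -
  have adjacent: "(\<lambda>v. v \<circ> Transposition.transpose b (b + 1)) \<in> weyl_group r"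
    if "1 \<le> b" "b + 1 \<le> r" for b
  proof -
    have "reflection r (simple_root r b) = (\<lambda>v. v \<circ> Transposition.transpose b (b + 1))"
      using that by (simp add: simple_root_def reflection_diff fun_eq_iff)
    then show ?thesis using weyl_group_reflection[of b r] that by simp
  qed
  show ?thesis using assms(3)
  proof (induction d)
    case 0
    then show ?case using adjacent[of a] assms(2) by (simp only: add_0_right)
  next
    case (Suc d)
    let ?b = "a + d + 1"
    let ?t = "Transposition.transpose ?b (?b + 1)"
    let ?u = "Transposition.transpose a ?b"
    have "(\<lambda>v. v \<circ> ?t) \<circ> ((\<lambda>v. v \<circ> ?u) \<circ> (\<lambda>v. v \<circ> ?t)) \<in> weyl_group r"
    proof -
      have "(\<lambda>v. v \<circ> ?u) \<in> weyl_group r" using Suc.prems by (intro Suc.IH) simp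
      moreover have "(\<lambda>v. v \<circ> ?t) \<in> weyl_group r" using Suc.prems by (intro adjacent) simp_all
      ultimately show ?thesis by (intro weyl_group_comp[OF assms(1)])
    qed
    moreover have "Transposition.transpose a (?b + 1) = ?t \<circ> ?u \<circ> ?t"
      by (auto simp: fun_eq_iff Transposition.transpose_def)
    ultimately show ?case by (simp add: o_def)
  qed
qed

lemma permutation_in_weyl_group:
  assumes "2 \<le> r" "\<pi> permutes {1..r}"
  shows "(\<lambda>v. v \<circ> \<pi>) \<in> weyl_group r"
  using assms(2) finite_atLeastAtMost
proof (induction rule: permutes_induct)
  case id
  show ?case using weyl_group_id[of r] by (simp add: id_def)
next
  case (swap a b p)
  have "(\<lambda>v. v \<circ> Transposition.transpose a b) \<in> weyl_group r"
    using \<open>a \<noteq> b\<close>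
  proof (cases a b rule: linorder_cases)
    case less
    then show ?thesis using transpose_in_weyl_group[OF assms(1), of a "b - a - 1"] swap by simp
  next
    case greater
    then show ?thesis using transpose_in_weyl_group[OF assms(1), of b "a - b - 1"] swap
      by (simp add: transpose_commute)
  qed simp
  then have "(\<lambda>v. v \<circ> p) \<circ> (\<lambda>v. v \<circ> Transposition.transpose a b) \<in> weyl_group r"
    using swap by (intro weyl_group_comp[OF assms(1)])
  then show ?case by (simp add: o_def)
qed

section \<open>Positivity of the partition function\<close>

text \<open>
  Linear functionals that are nonnegative on the positive roots are the source of all necessary
  conditions. On \<open>\<epsilon>\<^sub>i \<plusminus> \<epsilon>\<^sub>j\<close> the functional with coefficients \<open>w\<close> takes the value \<open>w i \<plusminus> w j\<close>.
\<close>

lemma ip_dominant_pos_root: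
  assumes "\<And>i j. 1 \<le> i \<Longrightarrow> i < j \<Longrightarrow> j \<le> r \<Longrightarrow> w i - \<bar>w j\<bar> \<ge> c"
    and "\<alpha> \<in> pos_roots r"
  shows "ip r w \<alpha> \<ge> c"
proof -
  obtain i j where "1 \<le> i" "i < j" "j \<le> r" "\<alpha> = eps i - eps j \<or> \<alpha> = eps i + eps j"
    using assms(2) by (rule pos_roots_cases)
  then show ?thesis using assms(1)[of i j]
    by (auto simp: ip_diff_right ip_add_right ip_eps)
qed

text \<open>
  Useful choices of \<open>w\<close> are the indicator functions of initial segments, which yield the partial sums
  of \<open>\<xi>\<close>, and \<open>(1, \<dots>, 1, -1)\<close>.
\<close>

lemma partition_fun_pos_imp:
  assumes "partition_fun r \<xi> > 0"
    and "\<And>i j. 1 \<le> i \<Longrightarrow> i < j \<Longrightarrow> j \<le> r \<Longrightarrow> \<bar>w j\<bar> \<le> w i"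
  shows "0 \<le> ip r w \<xi>"
proof -
  have "{c \<in> pos_roots r \<rightarrow>\<^sub>E (UNIV :: nat set).
      (\<Sum>\<alpha>\<in>pos_roots r. scale (real (c \<alpha>)) \<alpha>) = \<xi>} \<noteq> {}"
    using assms(1) unfolding partition_fun_def by (metis card.empty less_irrefl)
  then obtain c :: "vec \<Rightarrow> nat" where "\<xi> = (\<Sum>\<alpha>\<in>pos_roots r. scale (real (c \<alpha>)) \<alpha>)"
    by blast
  then have "ip r w \<xi> = (\<Sum>\<alpha>\<in>pos_roots r. real (c \<alpha>) * ip r w \<alpha>)"
    by (simp only: ip_sum_right ip_scale_right)
  also have "\<dots> \<ge> 0"
    using ip_dominant_pos_root[of r 0 w] assms(2) by (intro sum_nonneg mult_nonneg_nonneg) auto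
  finally show ?thesis .
qed

text \<open>
  The cardinality of an infinite set is \<open>0\<close>, so a positive value of the partition function also requires
  finiteness. The functional with coefficients \<open>r - k\<close> is at least \<open>1\<close> on all positive roots, hence its
  value at \<open>\<xi>\<close> bounds every multiplicity.
\<close>

lemma finite_decompositions:
  "finite {c \<in> pos_roots r \<rightarrow>\<^sub>E (UNIV :: nat set).
     (\<Sum>\<alpha>\<in>pos_roots r. scale (real (c \<alpha>)) \<alpha>) = \<xi>}" (is "finite ?D")
proof -
  define h where "h = ip r (\<lambda>k. real r - real k)"
  have h: "h \<alpha> \<ge> 1" if "\<alpha> \<in> pos_roots r" for \<alpha>
    unfolding h_def by (rule ip_dominant_pos_root[OF _ that]) simp
  have bound: "c \<alpha> \<le> nat \<lceil>h \<xi>\<rceil>" if c: "c \<in> ?D" and \<alpha>: "\<alpha> \<in> pos_roots r" for c \<alpha>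
  proof -
    have "h \<xi> = (\<Sum>\<beta>\<in>pos_roots r. real (c \<beta>) * h \<beta>)"
      using c unfolding h_def by (simp only: ip_sum_right[symmetric] ip_scale_right[symmetric]) auto
    moreover have "real (c \<alpha>) * h \<alpha> \<le> (\<Sum>\<beta>\<in>pos_roots r. real (c \<beta>) * h \<beta>)"
      using \<alpha> h by (intro member_le_sum finite_pos_roots mult_nonneg_nonneg) (auto, force)
    moreover have "real (c \<alpha>) \<le> real (c \<alpha>) * h \<alpha>"
      using mult_left_mono[OF h[OF \<alpha>], of "real (c \<alpha>)"] by simp
    ultimately have "real (c \<alpha>) \<le> h \<xi>" by linarith
    then show ?thesis by linarith
  qed
  have "?D \<subseteq> pos_roots r \<rightarrow>\<^sub>E {..nat \<lceil>h \<xi>\<rceil>}"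
  proof
    fix c assume "c \<in> ?D"
    then show "c \<in> pos_roots r \<rightarrow>\<^sub>E {..nat \<lceil>h \<xi>\<rceil>}" using bound[of c] by (auto simp: PiE_iff)
  qed
  then show ?thesis by (rule finite_subset) (intro finite_PiE finite_pos_roots finite_atMost)
qed

text \<open>
  Such a combination is itself a decomposition: the simple roots are positive roots, and the
  multiplicity of a root collects the coefficients along the fibre of \<open>simple_root r\<close> over it.
\<close>

lemma partition_fun_pos:
  assumes "2 \<le> r" "\<xi> = (\<Sum>i\<in>{1..r}. scale (real (n i)) (simple_root r i))"
  shows "partition_fun r \<xi> > 0"
proof -
  define c where "c = restrict (\<lambda>\<alpha>. \<Sum>i | i \<in> {1..r} \<and> simple_root r i = \<alpha>. n i) (pos_roots r)"
  have "(\<Sum>\<alpha>\<in>pos_roots r. scale (real (c \<alpha>)) \<alpha>) k = \<xi> k" for k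
  proof -
    have "(\<Sum>\<alpha>\<in>pos_roots r. scale (real (c \<alpha>)) \<alpha>) k =
        (\<Sum>\<alpha>\<in>pos_roots r. \<Sum>i | i \<in> {1..r} \<and> simple_root r i = \<alpha>. real (n i) * simple_root r i k)"
      unfolding sum_fun_apply by (intro sum.cong) (auto simp: c_def sum_distrib_right)
    also have "\<dots> = (\<Sum>i\<in>{1..r}. real (n i) * simple_root r i k)"
      using simple_root_in_pos_roots[OF assms(1)] by (intro sum.group finite_pos_roots) auto
    finally show ?thesis unfolding assms(2) sum_fun_apply by simp
  qed
  then have "c \<in> {c \<in> pos_roots r \<rightarrow>\<^sub>E (UNIV :: nat set).
      (\<Sum>\<alpha>\<in>pos_roots r. scale (real (c \<alpha>)) \<alpha>) = \<xi>}"
    by (auto simp: c_def)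
  then show ?thesis unfolding partition_fun_def card_gt_0_iff
    using finite_decompositions by blast
qed

lemma simple_root_combination_apply:
  assumes "2 \<le> r"
  shows "(\<Sum>i\<in>{1..r}. scale (n i) (simple_root r i)) k =
    (if 1 \<le> k \<and> k < r then n k else 0) - (if 2 \<le> k \<and> k \<le> r then n (k - 1) else 0)
    + (if k = r - 1 \<or> k = r then n r else 0)"
proof -
  have "{1..r} = insert r {1..<r}" using assms by auto
  then have "(\<Sum>i\<in>{1..r}. scale (n i) (simple_root r i)) k =
      n r * simple_root r r k + (\<Sum>i\<in>{1..<r}. n i * simple_root r i k)"
    unfolding sum_fun_apply scale_apply by simp
  moreover have "(\<Sum>i\<in>{1..<r}. n i * simple_root r i k) =
      (\<Sum>i\<in>{1..<r}. (if i = k then n i else 0) - (if i = k - 1 then n i else 0))"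
    by (rule sum.cong) (auto simp: simple_root_def eps_def)
  moreover have "\<dots> = (if 1 \<le> k \<and> k < r then n k else 0) - (if 2 \<le> k \<and> k \<le> r then n (k - 1) else 0)"
    unfolding sum_subtractf sum.delta'[OF finite_atLeastLessThan]
      sum.delta[OF finite_atLeastLessThan] using assms
    by (intro arg_cong2[where f = minus] if_cong) auto
  moreover have "n r * simple_root r r k = (if k = r - 1 \<or> k = r then n r else 0)"
    using assms by (auto simp: simple_root_def eps_def)
  ultimately show ?thesis by linarith
qed

text \<open>
  The coordinates of \<open>\<xi>\<close> in the basis of simple roots: the coefficient of \<open>\<alpha>\<^sub>i\<close> is the \<open>i\<close>-th partial sum
  for \<open>i \<le> r - 2\<close>, while the last two coefficients \<open>c\<close>, \<open>c'\<close> are determined by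
  \<open>c + c' = \<xi>\<^sub>1 + \<dots> + \<xi>\<^bsub>r-1\<^esub>\<close> and \<open>c' - c = \<xi>\<^sub>r\<close>.
\<close>

lemma partition_fun_pos_partial_sums:
  assumes r: "2 \<le> r" and supp: "\<And>k. k \<notin> {1..r} \<Longrightarrow> \<xi> k = 0"
    and inner: "\<And>t. t \<in> {1..r - 2} \<Longrightarrow> (\<Sum>k\<in>{1..t}. \<xi> k) \<in> \<nat>"
    and minus: "((\<Sum>k\<in>{1..r - 1}. \<xi> k) - \<xi> r) / 2 \<in> \<nat>"
    and plus: "((\<Sum>k\<in>{1..r - 1}. \<xi> k) + \<xi> r) / 2 \<in> \<nat>"
  shows "partition_fun r \<xi> > 0"
proof -
  define S where "S t = (\<Sum>k\<in>{1..t}. \<xi> k)" for t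
  define m where "m i = (if i = r then (S (r - 1) + \<xi> r) / 2
    else if i = r - 1 then (S (r - 1) - \<xi> r) / 2 else S i)" for i
  have S_step: "S k = S (k - 1) + \<xi> k" if "1 \<le> k" for k
    using that unfolding S_def by (cases k) simp_all
  have S_0: "S 0 = 0" by (simp add: S_def)
  have "m i \<in> \<nat>" if "i \<in> {1..r}" for i
    using that minus plus inner[of i] by (auto simp: m_def S_def)
  then have "\<forall>i\<in>{1..r}. \<exists>n. m i = real n" by (metis Nats_cases)
  then obtain n where "\<And>i. i \<in> {1..r} \<Longrightarrow> m i = real (n i)" by metis
  then have n: "real (n i) = m i" if "1 \<le> i" "i \<le> r" for i using that by simp
  have "\<xi> k = (\<Sum>i\<in>{1..r}. scale (real (n i)) (simple_root r i)) k" for k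
  proof -
    have *: "(\<Sum>i\<in>{1..r}. scale (real (n i)) (simple_root r i)) k =
        (if 1 \<le> k \<and> k < r then m k else 0) - (if 2 \<le> k \<and> k \<le> r then m (k - 1) else 0)
        + (if k = r - 1 \<or> k = r then m r else 0)"
      unfolding simple_root_combination_apply[OF r]
      using r by (intro arg_cong2[where f = "(+)"] arg_cong2[where f = "(-)"] if_cong refl n) auto
    consider "k \<notin> {1..r}" | "k = r" | "k = r - 1" "k \<ge> 1" | "1 \<le> k" "k < r - 1"
      by fastforce
    then show ?thesis
    proof cases
      case 1
      then show ?thesis unfolding * using supp[of k] r by auto
    next
      case 2
      then show ?thesis unfolding * using r by (auto simp: m_def field_simps)
    next
      case 3
      show ?thesis
      proof (cases "r = 2")
        case True
        then show ?thesis unfolding * using 3 S_step[of 1] S_0 by (auto simp: m_def field_simps)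
      next
        case False
        then show ?thesis unfolding * using 3 r S_step[of k] by (auto simp: m_def field_simps)
      qed
    next
      case 4
      show ?thesis
      proof (cases "k = 1")
        case True
        then show ?thesis unfolding * using 4 S_step[of 1] S_0 by (auto simp: m_def)
      next
        case False
        then show ?thesis unfolding * using 4 S_step[of k] by (auto simp: m_def)
      qed
    qed
  qed
  then have "\<xi> = (\<Sum>i\<in>{1..r}. scale (real (n i)) (simple_root r i))" by (rule ext)
  then show ?thesis by (rule partition_fun_pos[OF r])
qed

section \<open>The alternation set of the sum of the simple roots\<close>

text \<open>The vector \<open>\<lambda> + \<rho> = (r, r - 2, r - 3, \<dots>, 3, 2, 2, 0)\<close>.\<close>

definition shifted_weight :: "nat \<Rightarrow> vec" where
  "shifted_weight r =
     (\<lambda>k. if k = 1 then real r else if k \<in> {2..<r} then real (max 2 (r - k)) else 0)"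

lemma sum_simple_roots_plus_rho:
  assumes "4 \<le> r"
  shows "(\<Sum>i\<in>{1..r}. simple_root r i) + rho r = shifted_weight r"
proof
  fix k
  have "(\<Sum>i\<in>{1..r}. simple_root r i) k = (\<Sum>i\<in>{1..r}. scale 1 (simple_root r i)) k"
    unfolding sum_fun_apply by simp
  also have "\<dots> = (if 1 \<le> k \<and> k < r then 1 else 0) - (if 2 \<le> k \<and> k \<le> r then 1 else 0)
      + (if k = r - 1 \<or> k = r then 1 else 0)"
    using assms by (intro simple_root_combination_apply) simp
  finally have "((\<Sum>i\<in>{1..r}. simple_root r i) + rho r) k = \<dots> + rho r k" by simp
  also have "\<dots> = shifted_weight r k"
  proof -
    consider "k = 0 \<or> k > r" | "k = 1" | "2 \<le> k" "k < r - 1" | "k = r - 1" | "k = r"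
      using assms by linarith
    then show ?thesis using assms by cases (auto simp: rho_apply shifted_weight_def)
  qed
  finally show "((\<Sum>i\<in>{1..r}. simple_root r i) + rho r) k = shifted_weight r k" .
qed

lemma sum_permuted_shifted_weight:
  assumes "4 \<le> r" "\<pi> permutes {1..r}"
  shows "(\<Sum>k\<in>{1..r}. shifted_weight r (\<pi> k)) = (\<Sum>k\<in>{1..r}. rho r k) + 2"
proof -
  have "(\<Sum>k\<in>{1..r}. shifted_weight r (\<pi> k)) = (\<Sum>k\<in>{1..r}. shifted_weight r k)"
    using sum.permute[OF assms(2), of "shifted_weight r"] by (simp add: o_def)
  also have "\<dots> = (\<Sum>k\<in>{1..r}. rho r k + ((if k = 1 then 1 else 0) + (if k = r - 1 then 1 else 0)))"
    using assms(1) by (intro sum.cong) (auto simp: rho_apply shifted_weight_def max_def)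
  also have "\<dots> = (\<Sum>k\<in>{1..r}. rho r k) + 2"
    unfolding sum.distrib using assms(1) by simp
  finally show ?thesis .
qed

lemma partial_sum_permuted_shifted_weight:
  assumes "4 \<le> r" "\<pi> permutes {2..<r}" "t \<in> {2..r}"
  shows "(\<Sum>k\<in>{1..t - 1}. shifted_weight r (\<pi> k) - rho r k) =
    real (1 + (\<Sum>k=2..<t. max 2 (r - \<pi> k))) - real (\<Sum>k=2..<t. r - k)"
proof -
  have "{1..t - 1} = insert 1 {2..<t}" using assms(3) by auto
  moreover have "\<pi> 1 = 1" by (rule permutes_not_in[OF assms(2)]) simp
  ultimately have "(\<Sum>k\<in>{1..t - 1}. shifted_weight r (\<pi> k) - rho r k) =
      1 + (\<Sum>k=2..<t. shifted_weight r (\<pi> k) - rho r k)"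
    using assms(1) by (simp add: shifted_weight_def rho_apply)
  also have "(\<Sum>k=2..<t. shifted_weight r (\<pi> k) - rho r k) =
      (\<Sum>k=2..<t. real (max 2 (r - \<pi> k)) - real (r - k))"
  proof (rule sum.cong)
    fix k assume k: "k \<in> {2..<t}"
    then have "\<pi> k \<in> {2..<r}" using permutes_in_image[OF assms(2)] assms(3) by simp
    then show "shifted_weight r (\<pi> k) - rho r k = real (max 2 (r - \<pi> k)) - real (r - k)"
      using k assms(3) by (simp add: shifted_weight_def rho_apply)
  qed simp
  finally show ?thesis by (simp only: sum_subtractf of_nat_add of_nat_sum of_nat_1 add_diff_eq)
qed

text \<open>
  The functionals of \<open>partition_fun_pos_imp\<close> are used one after the other: the full sum removes the
  signs, \<open>(1, \<dots>, 1, -1)\<close> fixes the last position, the first coordinate fixes the first position, and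
  the partial sums are then the inequalities that define \<open>near_dominating\<close>.
\<close>

lemma alternation_set_subset:
  assumes r: "4 \<le> r" and \<sigma>: "\<sigma> \<in> alternation_set r (\<Sum>i\<in>{1..r}. simple_root r i) 0"
  shows "\<exists>\<pi>\<in>near_dominating r 2. \<sigma> = (\<lambda>v. v \<circ> \<pi>)"
proof -
  define b where "b = shifted_weight r"
  from \<sigma> have "\<sigma> \<in> weyl_group r" and pos: "partition_fun r (\<sigma> b - rho r) > 0"
    unfolding alternation_set_def b_def sum_simple_roots_plus_rho[OF r] by auto
  then obtain \<pi> s where \<pi>s: "even_signed_perm r \<pi> s" and \<sigma>_eq: "\<sigma> = (\<lambda>v k. s k * v (\<pi> k))"
    using weyl_group_even_signed_perm[of \<sigma> r] r by auto
  have \<pi>: "\<pi> permutes {1..r}" and s: "s k = 1 \<or> s k = -1" for k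
    using \<pi>s by (auto simp: even_signed_perm_def)
  have in_range: "\<pi> k \<in> {1..r}" if "k \<in> {1..r}" for k
    using permutes_in_image[OF \<pi>] that by blast
  have test: "0 \<le> (\<Sum>k\<in>{1..r}. w k * (s k * b (\<pi> k) - rho r k))"
    if "\<And>i j. 1 \<le> i \<Longrightarrow> i < j \<Longrightarrow> j \<le> r \<Longrightarrow> \<bar>w j\<bar> \<le> w i" for w :: vec
    using partition_fun_pos_imp[OF pos that] by (simp add: ip_def \<sigma>_eq)
  have b_nonneg: "0 \<le> b k" for k by (simp add: b_def shifted_weight_def)
  have b_le_1: "k = r" if "k \<in> {1..r}" "b k \<le> 1" for k
    using that r by (auto simp: b_def shifted_weight_def max_def split: if_splits)
  have total: "(\<Sum>k\<in>{1..r}. b (\<pi> k)) = (\<Sum>k\<in>{1..r}. rho r k) + 2"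
    unfolding b_def by (rule sum_permuted_shifted_weight[OF r \<pi>])

  \<comment> \<open>A negative sign lowers the total sum, which exceeds that of \<open>\<rho>\<close> by only \<open>2\<close>,
    by twice the entry.\<close>
  have plus_off_zero: "s k = 1" if k: "k \<in> {1..r}" "\<pi> k \<noteq> r" for k
  proof (rule ccontr)
    assume "s k \<noteq> 1"
    then have "2 * b (\<pi> k) = (1 - s k) * b (\<pi> k)" using s[of k] by auto
    also have "\<dots> \<le> (\<Sum>k\<in>{1..r}. (1 - s k) * b (\<pi> k))"
    proof (rule member_le_sum[OF k(1)])
      fix x show "0 \<le> (1 - s x) * b (\<pi> x)" using s[of x] b_nonneg[of "\<pi> x"] by auto
    qed simp
    also have "\<dots> \<le> 2"
      using test[of "\<lambda>_. 1"] total by (simp add: sum_subtractf left_diff_distrib)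
    finally have "b (\<pi> k) \<le> 1" by simp
    then show False using b_le_1 in_range k by blast
  qed
  \<comment> \<open>The sign of the entry \<open>0\<close> is the only one left undetermined, so it equals the product
    of all signs.\<close>
  have plus: "s k = 1" for k
  proof (cases "k \<in> {1..r} \<and> \<pi> k = r")
    case True
    have "s x = 1" if "x \<in> {1..r} - {k}" for x
    proof -
      have "\<pi> x \<noteq> r" using that True permutes_inj[OF \<pi>] by (metis DiffD2 injD insertI1)
      then show ?thesis using plus_off_zero that by blast
    qed
    then have "(\<Prod>x\<in>{1..r} - {k}. s x) = 1" by (intro prod.neutral) blast
    moreover have "(\<Prod>x\<in>{1..r}. s x) = s k * (\<Prod>x\<in>{1..r} - {k}. s x)"
      using True by (intro prod.remove) auto
    ultimately show ?thesis using \<pi>s by (simp add: even_signed_perm_def)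
  next
    case False
    then show ?thesis using plus_off_zero \<pi>s by (auto simp: even_signed_perm_def)
  qed
  have \<sigma>_perm: "\<sigma> = (\<lambda>v. v \<circ> \<pi>)" by (simp add: \<sigma>_eq plus fun_eq_iff)

  have last: "\<pi> r = r"
  proof -
    let ?\<xi> = "\<lambda>k. b (\<pi> k) - rho r k"
    have "0 \<le> (\<Sum>k\<in>{1..r}. (if k = r then -1 else 1) * ?\<xi> k)"
      using test[of "\<lambda>k. if k = r then -1 else 1"] plus by simp
    also have "\<dots> = (\<Sum>k\<in>{1..r}. ?\<xi> k - (if k = r then 2 * ?\<xi> k else 0))"
      by (rule sum.cong) auto
    also have "\<dots> = 2 - 2 * ?\<xi> r"
      using r total by (simp add: sum_subtractf)
    finally have "0 \<le> 2 - 2 * ?\<xi> r" .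
    moreover have "rho r r = 0" by (simp add: rho_apply)
    ultimately have "b (\<pi> r) \<le> 1" by simp
    then show ?thesis using b_le_1 in_range[of r] r by simp
  qed
  have partial: "0 \<le> (\<Sum>k\<in>{1..t}. b (\<pi> k) - rho r k)" if "t \<le> r" for t
  proof -
    have "0 \<le> (\<Sum>k\<in>{1..r}. (if k \<le> t then 1 else 0) * (b (\<pi> k) - rho r k))"
      using test[of "\<lambda>k. if k \<le> t then 1 else 0"] plus by simp
    also have "\<dots> = (\<Sum>k\<in>{1..t}. b (\<pi> k) - rho r k)"
      using that by (intro sum.mono_neutral_cong_right) auto
    finally show ?thesis .
  qed
  have first: "\<pi> 1 = 1"
  proof -
    have "real r - 1 \<le> b (\<pi> 1)" using partial[of 1] r by (simp add: rho_apply)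
    then show ?thesis using r in_range[of 1]
      by (auto simp: b_def shifted_weight_def max_def split: if_splits)
  qed
  have \<pi>': "\<pi> permutes {2..<r}"
  proof (rule permutes_superset[OF \<pi>])
    fix x assume "x \<in> {1..r} - {2..<r}"
    then have "x = 1 \<or> x = r" by auto
    then show "\<pi> x = x" using first last by blast
  qed
  have "(\<Sum>k=2..<t. r - k) \<le> 1 + (\<Sum>k=2..<t. max 2 (r - \<pi> k))" if t: "t \<in> {2..r}" for t
  proof -
    have "t - 1 \<le> r" using t by auto
    from partial[OF this] show ?thesis
      unfolding b_def partial_sum_permuted_shifted_weight[OF r \<pi>' t] by linarith
  qed
  then have "\<pi> \<in> near_dominating r 2" using \<pi>' by (simp add: near_dominating_def)
  then show ?thesis using \<sigma>_perm by blast
qed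

text \<open>
  The last two coefficients of \<open>v - \<rho>\<close> are both \<open>1\<close>: its last entry is \<open>0\<close> and its entries add up to \<open>2\<close>.
\<close>

lemma alternation_set_supset:
  assumes r: "4 \<le> r" and nd: "\<pi> \<in> near_dominating r 2"
  shows "(\<lambda>v. v \<circ> \<pi>) \<in> alternation_set r (\<Sum>i\<in>{1..r}. simple_root r i) 0"
proof -
  from nd have \<pi>: "\<pi> permutes {2..<r}" by (simp add: near_dominating_def)
  then have \<pi>': "\<pi> permutes {1..r}" by (rule permutes_subset) auto
  have "\<pi> r = r" by (rule permutes_not_in[OF \<pi>]) simp
  define \<xi> where "\<xi> = (shifted_weight r \<circ> \<pi>) - rho r"
  have \<xi>: "\<xi> k = shifted_weight r (\<pi> k) - rho r k" for k by (simp add: \<xi>_def)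
  have \<xi>_r: "\<xi> r = 0" using \<open>\<pi> r = r\<close> r by (simp add: \<xi> shifted_weight_def rho_apply)
  have "partition_fun r \<xi> > 0"
  proof (rule partition_fun_pos_partial_sums)
    show "2 \<le> r" using r by simp
    show "\<xi> k = 0" if "k \<notin> {1..r}" for k
      using that permutes_not_in[OF \<pi>' that] r by (auto simp: \<xi> shifted_weight_def rho_apply)
    show "(\<Sum>k\<in>{1..t}. \<xi> k) \<in> \<nat>" if "t \<in> {1..r - 2}" for t
    proof -
      have t: "t + 1 \<in> {2..r}" using that by auto
      then have le: "(\<Sum>k=2..<t + 1. r - k) \<le> 1 + (\<Sum>k=2..<t + 1. max 2 (r - \<pi> k))"
        using nd unfolding near_dominating_def by blast
      have "(\<Sum>k\<in>{1..t}. \<xi> k) =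
          real (1 + (\<Sum>k=2..<t + 1. max 2 (r - \<pi> k)) - (\<Sum>k=2..<t + 1. r - k))"
        using partial_sum_permuted_shifted_weight[OF r \<pi> t]
        unfolding of_nat_diff[OF le] \<xi> add_diff_cancel_right' .
      then show ?thesis by (simp only: of_nat_in_Nats)
    qed
    have "(\<Sum>k\<in>{1..r}. \<xi> k) = 2"
      using sum_permuted_shifted_weight[OF r \<pi>'] by (simp add: \<xi> sum_subtractf)
    moreover have "{1..r} = insert r {1..r - 1}" using r by auto
    ultimately have "(\<Sum>k\<in>{1..r - 1}. \<xi> k) = 2" using r \<xi>_r by simp
    then show "((\<Sum>k\<in>{1..r - 1}. \<xi> k) - \<xi> r) / 2 \<in> \<nat>"
      and "((\<Sum>k\<in>{1..r - 1}. \<xi> k) + \<xi> r) / 2 \<in> \<nat>"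
      using \<xi>_r by simp_all
  qed
  moreover have "(\<lambda>v. v \<circ> \<pi>) \<in> weyl_group r"
    using r by (intro permutation_in_weyl_group[OF _ \<pi>']) simp
  ultimately show ?thesis
    unfolding alternation_set_def sum_simple_roots_plus_rho[OF r] \<xi>_def by simp
qed

theorem corollary4p1:
  fixes r :: nat
  assumes "r \<ge> 4"
  shows "card (alternation_set r (\<Sum>i\<in>{1..r}. simple_root r i) 0) = 2 * lucas (r - 3)"
proof -
  have "alternation_set r (\<Sum>i\<in>{1..r}. simple_root r i) 0 =
      (\<lambda>\<pi> v. v \<circ> \<pi>) ` near_dominating r 2"
    using alternation_set_subset[OF assms] alternation_set_supset[OF assms] by blast
  moreover have "inj_on (\<lambda>\<pi> (v :: vec). v \<circ> \<pi>) (near_dominating r 2)"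
  proof (rule inj_onI)
    fix \<pi> \<pi>' :: "nat \<Rightarrow> nat"
    assume "(\<lambda>v :: vec. v \<circ> \<pi>) = (\<lambda>v. v \<circ> \<pi>')"
    \<comment> \<open>A vector with distinct entries recovers the permutation.\<close>
    from fun_cong[OF this, of real] show "\<pi> = \<pi>'" by (simp add: fun_eq_iff)
  qed
  ultimately have "card (alternation_set r (\<Sum>i\<in>{1..r}. simple_root r i) 0) =
      card (near_dominating r 2)"
    by (simp add: card_image)
  also have "\<dots> = 2 * lucas (Suc (r - 4))"
    by (rule card_near_dominating) (use assms in simp)
  also have "Suc (r - 4) = r - 3" using assms by simp
  finally show ?thesis .
qed

end
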